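(* Let $I \supset [0,\infty)$ be an open interval and let $f : I \to (0,\infty)$ be differentiable. Let $a \in [0,\infty)$, $b \ge 1$, $a<b$, and $(\alpha,m) \in (0,1]\times(0,1]$. Suppose that $f' \in L[a,b]$, that $|f'|$ is decreasing and $(\alpha,m)$-geometrically convex on $[\min\{1,a\},b]$, and that $|f'(y)| \le M \le 1$ for all $y \in [\min\{1,a\},b]$. Then for every $\mu>0$ and every $x \in [a,b]$, $$\left| \frac{(x-a)^{\mu}+(b-x)^{\mu}}{b-a} f(x) - \frac{\Gamma(\mu+1)}{b-a}\left[ J_{x^-}^{\mu} f(a) + J_{x^+}^{\mu} f(b) \right] \right| \le \left[ \frac{(x-a)^{\mu+1}+(b-x)^{\mu+1}}{b-a} \right] k(\alpha),$$ where $$k(\alpha) = \begin{cases} M^{m} \int_0^1 t^{\mu} M^{t\alpha(1-m)}\,dt, & M<1,\\[2pt] \dfrac{1}{\mu+1}, & M=1. \end{cases}$$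
   Context: Let $(\alpha,m)\in(0,1]\times(0,1]$. A positive function $g$ is $(\alpha,m)$-geometrically convex on an interval $J\subset[0,\infty)$ if $g\left(x^{t}y^{m(1-t)}\right) \le [g(x)]^{t^{\alpha}}[g(y)]^{m(1-t^{\alpha})}$ for all $x,y\in J$ and $t\in[0,1]$. $L[a,b]$ denotes the Lebesgue integrable functions on $[a,b]$, and $\Gamma$ is the Gamma function. The Riemann-Liouville fractional integrals of order $\mu>0$ are $J_{c^+}^{\mu} f(x)=\frac{1}{\Gamma(\mu)}\int_c^x (x-t)^{\mu-1}f(t)\,dt$ for $x>c$ and $J_{d^-}^{\mu} f(x)=\frac{1}{\Gamma(\mu)}\int_x^d (t-x)^{\mu-1}f(t)\,dt$ for $x<d$. Thus $J_{x^-}^{\mu} f(a)=\frac{1}{\Gamma(\mu)}\int_a^x (t-a)^{\mu-1}f(t)\,dt$ and $J_{x^+}^{\mu} f(b)=\frac{1}{\Gamma(\mu)}\int_x^b (b-t)^{\mu-1}f(t)\,dt$ (each being $0$ when the integration interval is a point). *)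

theory Defs
  imports "HOL-Analysis.Analysis"
begin

text \<open>
  Real power of a nonnegative base with the usual convention \<open>0\<^sup>0 = 1\<close>; in the library,
  \<open>0 powr 0 = 0\<close>. The two agree for positive bases and for nonzero exponents.
\<close>

definition rpow :: "real \<Rightarrow> real \<Rightarrow> real" where
  "rpow x s = (if s = 0 then 1 else x powr s)"

text \<open>
  The parameters are meant to satisfy \<open>0 < \<alpha> \<le> 1\<close>, \<open>0 < m \<le> 1\<close>, and \<open>J\<close> to be an interval of
  nonnegative reals. Since \<open>J\<close> may contain \<open>0\<close> and \<open>t\<close> may be \<open>0\<close> or \<open>1\<close>, the powers of
  \<open>x\<close> and \<open>y\<close> need \<open>0\<^sup>0 = 1\<close>; all other bases are positive or have a positive exponent.
\<close>

definition geometrically_convex_on :: "real \<Rightarrow> real \<Rightarrow> real set \<Rightarrow> (real \<Rightarrow> real) \<Rightarrow> bool" where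
  "geometrically_convex_on \<alpha> m J g \<longleftrightarrow>
     (\<forall>x\<in>J. 0 < g x) \<and>
     (\<forall>x\<in>J. \<forall>y\<in>J. \<forall>t\<in>{0..1}.
        g (rpow x t * rpow y (m * (1 - t)))
          \<le> g x powr (t powr \<alpha>) * g y powr (m * (1 - t powr \<alpha>)))"

text \<open>
  Left-sided (\<open>J\<^bsub>c+\<^esub>\<^bsup>\<mu>\<^esup> f x\<close>, for \<open>c \<le> x\<close>) and right-sided (\<open>J\<^bsub>d-\<^esub>\<^bsup>\<mu>\<^esup> f x\<close>, for \<open>x \<le> d\<close>)
  Riemann--Liouville integrals, as Lebesgue integrals.
\<close>

definition RL_left :: "real \<Rightarrow> real \<Rightarrow> (real \<Rightarrow> real) \<Rightarrow> real \<Rightarrow> real" where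
  "RL_left \<mu> c f x = 1 / Gamma \<mu> * (LINT t:{c..x}|lebesgue. (x - t) powr (\<mu> - 1) * f t)"

definition RL_right :: "real \<Rightarrow> real \<Rightarrow> (real \<Rightarrow> real) \<Rightarrow> real \<Rightarrow> real" where
  "RL_right \<mu> d f x = 1 / Gamma \<mu> * (LINT t:{x..d}|lebesgue. (t - x) powr (\<mu> - 1) * f t)"

text \<open>Only used for \<open>M \<le> 1\<close>, so the second branch is the case \<open>M = 1\<close>.\<close>

definition k_const :: "real \<Rightarrow> real \<Rightarrow> real \<Rightarrow> real \<Rightarrow> real" where
  "k_const \<mu> m M \<alpha> =
     (if M < 1
      then M powr m * (LINT t:{0..1}|lebesgue. t powr \<mu> * M powr (t * \<alpha> * (1 - m)))
      else 1 / (\<mu> + 1))"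

end

theory Submission imports Defs begin

text \<open>
  Since \<open>M \<le> 1\<close> and the exponent \<open>m + t * \<alpha> * (1 - m)\<close> is at most \<open>1\<close>, the constant \<open>k(\<alpha>)\<close> is at
  least \<open>M / (\<mu> + 1)\<close>, so only the Lipschitz bound \<open>\<bar>f x - f t\<bar> \<le> M * \<bar>x - t\<bar>\<close> is needed:
  \<open>(x - a)\<^sup>\<mu> f x\<close> minus \<open>\<Gamma>(\<mu> + 1)\<close> times the fractional integral is the integral of
  \<open>\<mu> (t - a)\<^bsup>\<mu> - 1\<^esup> (f x - f t)\<close>, whose absolute value is at most
  \<open>M * (x - a)\<^bsup>\<mu> + 1\<^esup> / (\<mu> + 1)\<close>; likewise on \<open>[x, b]\<close>.
\<close>

lemma has_integral_powr_from_left: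
  fixes a x p :: real
  assumes "a \<le> x" "p > -1"
  shows "((\<lambda>t. (t - a) powr p) has_integral (x - a) powr (p + 1) / (p + 1)) {a..x}"
  using has_integral_affinity[OF has_integral_powr_from_0[of p "x - a", unfolded cbox_interval[symmetric]], of 1 "- a"] assms
  by (simp add: image_add_atLeastAtMost' cong: image_cong_simp)

lemma has_integral_powr_from_right:
  fixes b x p :: real
  assumes "x \<le> b" "p > -1"
  shows "((\<lambda>t. (b - t) powr p) has_integral (b - x) powr (p + 1) / (p + 1)) {x..b}"
  using has_integral_affinity[OF has_integral_powr_from_0[of p "b - x", unfolded cbox_interval[symmetric]], of "-1" b] assms
  by (simp cong: image_cong_simp)

text \<open>A nonnegative gauge-integrable function is absolutely integrable. This carries explicit
  \<open>has_integral\<close> values over to the Lebesgue integrals in the definitions.\<close>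

lemma set_lebesgue_integral_unique_nonneg:
  fixes w :: "real \<Rightarrow> real"
  assumes "(w has_integral i) S" "\<And>t. t \<in> S \<Longrightarrow> 0 \<le> w t"
  shows "set_integrable lebesgue S w" "(LINT t:S|lebesgue. w t) = i"
proof -
  show *: "set_integrable lebesgue S w"
    using assms by (intro nonnegative_absolutely_integrable_1) (auto simp: has_integral_iff)
  show "(LINT t:S|lebesgue. w t) = i"
    using set_lebesgue_integral_eq_integral(2)[OF *] assms(1) by (simp add: integral_unique)
qed

text \<open>\<open>W * f x\<close> is the integral of \<open>w t * f x\<close>, so the difference is
  the integral of \<open>w t * (f x - f t)\<close>, which the Lipschitz bound dominates pointwise by
  \<open>M * (w t * \<bar>x - t\<bar>)\<close>.\<close>

lemma weighted_integral_lipschitz_bound: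
  fixes f w :: "real \<Rightarrow> real"
  assumes w: "(w has_integral W) {c..d}" and w0: "\<And>t. t \<in> {c..d} \<Longrightarrow> 0 \<le> w t"
    and v: "((\<lambda>t. w t * \<bar>x - t\<bar>) has_integral V) {c..d}"
    and cont: "continuous_on {c..d} f"
    and lip: "\<And>t. t \<in> {c..d} \<Longrightarrow> \<bar>f x - f t\<bar> \<le> M * \<bar>x - t\<bar>"
  shows "\<bar>W * f x - (LINT t:{c..d}|lebesgue. w t * f t)\<bar> \<le> M * V"
proof -
  note wi = set_lebesgue_integral_unique_nonneg(1)[OF w w0]
  \<comment> \<open>The weight may be unbounded, as \<open>(t - a) powr (\<mu> - 1)\<close> is for
    \<mu> < 1. Integrability comes from \<open>f\<close> being bounded and measurable, as it is
    continuous on a compact interval.\<close>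
  have "set_integrable lebesgue {c..d} (\<lambda>t. f t * w t)"
    using cont wi
    by (intro absolutely_integrable_bounded_measurable_product_real
        continuous_imp_measurable_on_sets_lebesgue compact_imp_bounded compact_continuous_image) auto
  then have wf: "set_integrable lebesgue {c..d} (\<lambda>t. w t * f t)"
    by (simp add: mult.commute)
  have "((\<lambda>t. w t * f x - w t * f t) has_integral
          (W * f x - (LINT t:{c..d}|lebesgue. w t * f t))) {c..d}"
    using set_lebesgue_integral_eq_integral[OF wf] w
    by (intro has_integral_diff has_integral_mult_left) (auto simp: has_integral_iff)
  moreover have "((\<lambda>t. M * (w t * \<bar>x - t\<bar>)) has_integral M * V) {c..d}"
    using v by (rule has_integral_mult_right)
  moreover have "\<bar>w t * f x - w t * f t\<bar> \<le> M * (w t * \<bar>x - t\<bar>)" if "t \<in> {c..d}" for t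
  proof -
    have "\<bar>w t * f x - w t * f t\<bar> = w t * \<bar>f x - f t\<bar>"
      using w0[OF that] by (simp add: abs_mult flip: right_diff_distrib)
    then show ?thesis
      using mult_left_mono[OF lip[OF that] w0[OF that]] by (simp add: algebra_simps)
  qed
  ultimately show ?thesis
    by (metis (no_types, lifting) integral_norm_bound_integral has_integral_iff real_norm_def)
qed

lemma Gamma_ratio:
  fixes \<mu> :: real
  assumes "0 < \<mu>"
  shows "Gamma (\<mu> + 1) * (1 / Gamma \<mu>) = \<mu>"
proof -
  have "\<mu> \<notin> \<int>\<^sub>\<le>\<^sub>0"
    using assms by (auto dest: nonpos_Ints_nonpos)
  then show ?thesis
    using Gamma_plus1[of \<mu>] Gamma_real_pos[OF assms] by simp
qed

text \<open>Common form of the two sides of \<open>x\<close>. Here \<open>u\<close> is the length of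
  the interval and, with \<open>s\<close> the distance from \<open>t\<close> to the endpoint other
  than \<open>x\<close>, \<open>w\<close> is \<open>s powr (\<mu> - 1)\<close> and \<open>v\<close>
  is \<open>s powr \<mu>\<close>. Assumption \<open>vw\<close> then expresses
  \<open>\<bar>x - t\<bar> = u - s\<close>.\<close>

lemma fractional_lipschitz_bound:
  fixes f w :: "real \<Rightarrow> real"
  assumes "0 \<le> u" "0 < \<mu>"
    and w: "(w has_integral u powr \<mu> / \<mu>) {c..d}" and w0: "\<And>t. t \<in> {c..d} \<Longrightarrow> 0 \<le> w t"
    and v: "(v has_integral u powr (\<mu> + 1) / (\<mu> + 1)) {c..d}"
    and vw: "\<And>t. t \<in> {c..d} \<Longrightarrow> w t * \<bar>x - t\<bar> = u * w t - v t"
    and cont: "continuous_on {c..d} f"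
    and lip: "\<And>t. t \<in> {c..d} \<Longrightarrow> \<bar>f x - f t\<bar> \<le> M * \<bar>x - t\<bar>"
  shows "\<bar>u powr \<mu> * f x
            - Gamma (\<mu> + 1) * (1 / Gamma \<mu> * (LINT t:{c..d}|lebesgue. w t * f t))\<bar>
           \<le> u powr (\<mu> + 1) * (M / (\<mu> + 1))"
proof -
  have "((\<lambda>t. u * w t - v t) has_integral
      u * (u powr \<mu> / \<mu>) - u powr (\<mu> + 1) / (\<mu> + 1)) {c..d}"
    using w v by (intro has_integral_diff has_integral_mult_right)
  \<comment> \<open>This is
    \<open>1 / \<mu> - 1 / (\<mu> + 1) = 1 / (\<mu> * (\<mu> + 1))\<close>.\<close>
  also have "u * (u powr \<mu> / \<mu>) - u powr (\<mu> + 1) / (\<mu> + 1) = u powr (\<mu> + 1) / (\<mu> * (\<mu> + 1))"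
    using \<open>0 \<le> u\<close> \<open>0 < \<mu>\<close> by (simp add: powr_add field_simps)
  finally have "((\<lambda>t. w t * \<bar>x - t\<bar>) has_integral u powr (\<mu> + 1) / (\<mu> * (\<mu> + 1))) {c..d}"
    by (rule has_integral_eq[rotated]) (simp add: vw)
  from weighted_integral_lipschitz_bound[OF w w0 this cont lip]
  \<comment> \<open>The factor \<mu> is the quotient of \<open>Gamma (\<mu> + 1)\<close> by
    \<open>Gamma \<mu>\<close>; it clears both denominators \<mu>.\<close>
  have "\<mu> * \<bar>u powr \<mu> / \<mu> * f x - (LINT t:{c..d}|lebesgue. w t * f t)\<bar>
      \<le> \<mu> * (M * (u powr (\<mu> + 1) / (\<mu> * (\<mu> + 1))))"
    using \<open>0 < \<mu>\<close> by (intro mult_left_mono) auto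
  also have "\<dots> = u powr (\<mu> + 1) * (M / (\<mu> + 1))"
    using \<open>0 < \<mu>\<close> by simp
  also have "\<mu> * \<bar>u powr \<mu> / \<mu> * f x - (LINT t:{c..d}|lebesgue. w t * f t)\<bar>
      = \<bar>\<mu> * (u powr \<mu> / \<mu> * f x - (LINT t:{c..d}|lebesgue. w t * f t))\<bar>"
    using \<open>0 < \<mu>\<close> by (simp add: abs_mult)
  also have "\<dots> = \<bar>u powr \<mu> * f x - \<mu> * (LINT t:{c..d}|lebesgue. w t * f t)\<bar>"
    using \<open>0 < \<mu>\<close> by (simp add: right_diff_distrib)
  finally show ?thesis
    unfolding mult.assoc[symmetric] Gamma_ratio[OF \<open>0 < \<mu>\<close>] .
qed

lemma RL_right_lipschitz_bound:
  fixes f :: "real \<Rightarrow> real"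
  assumes "a \<le> x" "0 < \<mu>" and cont: "continuous_on {a..x} f"
    and lip: "\<And>t. t \<in> {a..x} \<Longrightarrow> \<bar>f x - f t\<bar> \<le> M * \<bar>x - t\<bar>"
  shows "\<bar>(x - a) powr \<mu> * f x - Gamma (\<mu> + 1) * RL_right \<mu> x f a\<bar>
           \<le> (x - a) powr (\<mu> + 1) * (M / (\<mu> + 1))"
  unfolding RL_right_def
proof (rule fractional_lipschitz_bound[OF _ \<open>0 < \<mu>\<close> _ _ _ _ cont lip])
  show "((\<lambda>t. (t - a) powr (\<mu> - 1)) has_integral (x - a) powr \<mu> / \<mu>) {a..x}"
    using has_integral_powr_from_left[of a x "\<mu> - 1"] assms by simp
  show "((\<lambda>t. (t - a) powr \<mu>) has_integral (x - a) powr (\<mu> + 1) / (\<mu> + 1)) {a..x}"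
    using has_integral_powr_from_left[of a x \<mu>] assms by simp
  \<comment> \<open>Write \<open>x - t\<close> as \<open>(x - a) - (t - a)\<close>. The endpoint
    \<open>t = a\<close> is covered, because \<open>0 powr s = 0\<close> makes both sides
    vanish.\<close>
  show "(t - a) powr (\<mu> - 1) * \<bar>x - t\<bar> = (x - a) * (t - a) powr (\<mu> - 1) - (t - a) powr \<mu>"
    if "t \<in> {a..x}" for t
    using that powr_mult_base[of "t - a" "\<mu> - 1"] by (simp add: algebra_simps)
qed (use assms in auto)

lemma RL_left_lipschitz_bound:
  fixes f :: "real \<Rightarrow> real"
  assumes "x \<le> b" "0 < \<mu>" and cont: "continuous_on {x..b} f"
    and lip: "\<And>t. t \<in> {x..b} \<Longrightarrow> \<bar>f x - f t\<bar> \<le> M * \<bar>x - t\<bar>"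
  shows "\<bar>(b - x) powr \<mu> * f x - Gamma (\<mu> + 1) * RL_left \<mu> x f b\<bar>
           \<le> (b - x) powr (\<mu> + 1) * (M / (\<mu> + 1))"
  unfolding RL_left_def
proof (rule fractional_lipschitz_bound[OF _ \<open>0 < \<mu>\<close> _ _ _ _ cont lip])
  show "((\<lambda>t. (b - t) powr (\<mu> - 1)) has_integral (b - x) powr \<mu> / \<mu>) {x..b}"
    using has_integral_powr_from_right[of x b "\<mu> - 1"] assms by simp
  show "((\<lambda>t. (b - t) powr \<mu>) has_integral (b - x) powr (\<mu> + 1) / (\<mu> + 1)) {x..b}"
    using has_integral_powr_from_right[of x b \<mu>] assms by simp
  show "(b - t) powr (\<mu> - 1) * \<bar>x - t\<bar> = (b - x) * (b - t) powr (\<mu> - 1) - (b - t) powr \<mu>"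
    if "t \<in> {x..b}" for t
    using that powr_mult_base[of "b - t" "\<mu> - 1"] by (simp add: algebra_simps)
qed (use assms in auto)

text \<open>For \<open>M < 1\<close>, powers of \<open>M\<close> decrease in the exponent, so
  replacing \<open>t * \<alpha> * (1 - m)\<close> by its upper bound \<open>1 - m\<close> lowers the
  integrand. What remains integrates explicitly, and \<open>M powr m * M powr (1 - m) = M\<close>.
  For \<open>M = 1\<close> equality holds.\<close>

lemma k_const_ge:
  assumes "0 < M" "M \<le> 1" "0 < \<mu>" "0 \<le> \<alpha>" "\<alpha> \<le> 1" "0 \<le> m" "m \<le> 1"
  shows "M / (\<mu> + 1) \<le> k_const \<mu> m M \<alpha>"
proof (cases "M < 1")
  case True
  define g where "g t = t powr \<mu> * M powr (t * \<alpha> * (1 - m))" for t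
  have "continuous_on {0..1} g"
    unfolding g_def using assms by (intro continuous_on_mult continuous_on_powr' continuous_intros) auto
  then have gi: "(g has_integral integral {0..1} g) {0..1}"
    by (intro integrable_integral integrable_continuous_real)
  have "((\<lambda>t. t powr \<mu> * M powr (1 - m)) has_integral 1 / (\<mu> + 1) * M powr (1 - m)) {0..1}"
    using has_integral_powr_from_0[of \<mu> 1] assms by (intro has_integral_mult_left) auto
  then have "1 / (\<mu> + 1) * M powr (1 - m) \<le> integral {0..1} g"
  proof (rule has_integral_le[OF _ gi])
    fix t :: real assume t: "t \<in> {0..1}"
    then have "t * \<alpha> * (1 - m) \<le> 1 * (1 - m)"
      using assms by (intro mult_right_mono mult_le_one) auto
    then have "M powr (1 - m) \<le> M powr (t * \<alpha> * (1 - m))"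
      using assms by (intro powr_mono') auto
    then show "t powr \<mu> * M powr (1 - m) \<le> g t"
      unfolding g_def by (intro mult_left_mono) auto
  qed
  also have "integral {0..1} g = (LINT t:{0..1}|lebesgue. g t)"
    by (rule set_lebesgue_integral_unique_nonneg(2)[OF gi, symmetric]) (simp add: g_def)
  finally have "M powr m * (1 / (\<mu> + 1) * M powr (1 - m)) \<le> k_const \<mu> m M \<alpha>"
    using True unfolding k_const_def g_def by (simp only: if_True mult_left_mono powr_ge_zero)
  moreover have "M powr m * M powr (1 - m) = M"
    using assms by (simp flip: powr_add)
  ultimately show ?thesis
    by (simp add: mult.commute)
next
  case False
  then show ?thesis using assms by (simp add: k_const_def)
qed

theorem theorem2:
  fixes I :: "real set" and f :: "real \<Rightarrow> real" and a b \<alpha> m M \<mu> x :: real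
  assumes "open I" and "is_interval I" and "{0..} \<subseteq> I"
    and "\<And>y. y \<in> I \<Longrightarrow> 0 < f y"
    and "f differentiable_on I"
    and "0 \<le> a" and "1 \<le> b" and "a < b"
    and "0 < \<alpha>" and "\<alpha> \<le> 1" and "0 < m" and "m \<le> 1"
    and "set_integrable lebesgue {a..b} (deriv f)"
    and "antimono_on {min 1 a..b} (\<lambda>y. \<bar>deriv f y\<bar>)"
    and "geometrically_convex_on \<alpha> m {min 1 a..b} (\<lambda>y. \<bar>deriv f y\<bar>)"
    and "\<And>y. y \<in> {min 1 a..b} \<Longrightarrow> \<bar>deriv f y\<bar> \<le> M" and "M \<le> 1"
    and "0 < \<mu>" and "x \<in> {a..b}"
  shows "\<bar>((x - a) powr \<mu> + (b - x) powr \<mu>) / (b - a) * f x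
            - Gamma (\<mu> + 1) / (b - a) * (RL_right \<mu> x f a + RL_left \<mu> x f b)\<bar>
         \<le> ((x - a) powr (\<mu> + 1) + (b - x) powr (\<mu> + 1)) / (b - a) * k_const \<mu> m M \<alpha>"
proof -
  \<comment> \<open>As \<open>I\<close> is open, differentiability on \<open>I\<close> is two-sided
    even at \<open>a\<close> and \<open>b\<close>, so \<open>deriv f\<close> is the true derivative
    on all of \<open>{a..b}\<close>.\<close>
  have D: "(f has_real_derivative deriv f y) (at y within {a..b})" if "y \<in> {a..b}" for y
  proof -
    have "y \<in> I" using assms(3,6) that by auto
    then have "f differentiable at y"
      using assms(1,5) by (metis at_within_open differentiable_on_def)
    then show ?thesis
      by (auto simp: DERIV_deriv_iff_real_differentiable intro: has_field_derivative_at_within)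
  qed
  have lip: "\<bar>f x - f t\<bar> \<le> M * \<bar>x - t\<bar>" if "t \<in> {a..b}" for t
  proof -
    have "\<bar>deriv f y\<bar> \<le> M" if "y \<in> {a..b}" for y
      using assms(16) that by auto
    then show ?thesis
      using field_differentiable_bound[of "{a..b}" f "deriv f" M x t] D assms(19) that by auto
  qed
  have cont: "continuous_on {a..b} f"
    using D by (meson DERIV_continuous_on)
  \<comment> \<open>Geometric convexity includes strict positivity of
    \<open>\<bar>deriv f\<bar>\<close>; evaluated at \<open>b\<close>, it forces \<open>M\<close> to
    be positive.\<close>
  have "0 < \<bar>deriv f b\<bar>" "\<bar>deriv f b\<bar> \<le> M"
    using assms(7,8,15,16) by (auto simp: geometrically_convex_on_def)
  then have "0 < M"
    by linarith
  then have k: "M / (\<mu> + 1) \<le> k_const \<mu> m M \<alpha>"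
    using assms by (intro k_const_ge) auto
  \<comment> \<open>The left-hand side of the claim splits as \<open>(?R + ?L) / (b - a)\<close>,
    with \<open>?R\<close> coming from \<open>{a..x}\<close> and \<open>?L\<close> from
    \<open>{x..b}\<close>.\<close>
  let ?R = "(x - a) powr \<mu> * f x - Gamma (\<mu> + 1) * RL_right \<mu> x f a"
  let ?L = "(b - x) powr \<mu> * f x - Gamma (\<mu> + 1) * RL_left \<mu> x f b"
  let ?N = "(x - a) powr (\<mu> + 1) + (b - x) powr (\<mu> + 1)"
  have "\<bar>?R\<bar> \<le> (x - a) powr (\<mu> + 1) * (M / (\<mu> + 1))"
    using assms(18,19)
    by (intro RL_right_lipschitz_bound continuous_on_subset[OF cont] lip) auto
  moreover have "\<bar>?L\<bar> \<le> (b - x) powr (\<mu> + 1) * (M / (\<mu> + 1))"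
    using assms(18,19)
    by (intro RL_left_lipschitz_bound continuous_on_subset[OF cont] lip) auto
  ultimately have "\<bar>?R + ?L\<bar> \<le> ?N * (M / (\<mu> + 1))"
    unfolding distrib_right by linarith
  also have "\<dots> \<le> ?N * k_const \<mu> m M \<alpha>"
    using k by (intro mult_left_mono) auto
  finally have "\<bar>?R + ?L\<bar> / (b - a) \<le> ?N * k_const \<mu> m M \<alpha> / (b - a)"
    using assms(8) by (intro divide_right_mono) auto
  moreover have "\<bar>?R + ?L\<bar> / (b - a) = \<bar>(?R + ?L) / (b - a)\<bar>"
    using assms(8) by simp
  moreover have "(?R + ?L) / (b - a) = ((x - a) powr \<mu> + (b - x) powr \<mu>) / (b - a) * f x
      - Gamma (\<mu> + 1) / (b - a) * (RL_right \<mu> x f a + RL_left \<mu> x f b)"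
    by (simp add: algebra_simps add_divide_distrib diff_divide_distrib)
  ultimately show ?thesis
    by simp
qed

end
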